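(* Let $W\ge1$, $\beta>0$ and let $V_0\le V_1\le\dots\le V_W$ be real numbers. Let $y^{quad}$ be the quadratic response computed with parameter $\beta'=\beta e/4$, and $y^{log}$ the logit response computed with parameter $\beta$. Then for every $w\in\{1,\dots,W\}$: $$\text{if } y^{quad}_w=0,\ \text{ then }\ y^{log}_w\le\gamma_w:=\big(1+w\,e^{\frac{8}{we}}\big)^{-1}\ \ (\le 1/9).$$ Conversely, $$\text{if } y^{log}_w\le\eta^W_w:=\big(W+1+w(e^{\frac8e}-1)\big)^{-1},\ \text{ then }\ y^{quad}_w=0.$$
   Context: $e$ is Euler's number. $\Delta_{W+1}=\{y\in\mathbb{R}_{\ge0}^{W+1}:\sum_{w=0}^Wy_w=1\}$, coordinates indexed by $0,\dots,W$. The quadratic response with parameter $\beta'$ is the unique minimizer of $\sum_{w=0}^W(V_wy_w+\frac1{\beta'}y_w^2)$ over $y\in\Delta_{W+1}$. The logit response with parameter $\beta$ is $y^{log}_w=e^{-\beta V_w}/\sum_{k=0}^We^{-\beta V_k}$. *)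

theory Defs
  imports "HOL-Analysis.Analysis" "HOL-Homology.Simplices"
begin

text \<open>
  The simplex of dimension \<open>W\<close> (with \<open>W + 1\<close> coordinates, indexed by \<open>0, \<dots>, W\<close>) is the library's
  \<^const>\<open>standard_simplex\<close>, whose points are functions on \<^typ>\<open>nat\<close> that vanish beyond \<open>W\<close>.
  This padding is what makes the minimizer below unique as a function. The bound \<open>y w \<le> 1\<close> in the
  library definition is redundant.
\<close>

lemma standard_simplex_iff_nonneg_sum:
  "y \<in> standard_simplex W \<longleftrightarrow> (\<forall>w\<le>W. 0 \<le> y w) \<and> (\<forall>w>W. y w = 0) \<and> (\<Sum>w\<le>W. y w) = 1"
proof
  assume "(\<forall>w\<le>W. 0 \<le> y w) \<and> (\<forall>w>W. y w = 0) \<and> (\<Sum>w\<le>W. y w) = 1"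
  then have nn: "\<And>w. w \<le> W \<Longrightarrow> 0 \<le> y w" and z: "\<And>w. w > W \<Longrightarrow> y w = 0"
    and s: "(\<Sum>w\<le>W. y w) = 1" by auto
  have "0 \<le> y w \<and> y w \<le> 1" for w
  proof (cases "w \<le> W")
    case True
    then have "y w \<le> (\<Sum>w\<le>W. y w)" using nn by (intro member_le_sum) auto
    then show ?thesis using nn s True by simp
  qed (use z in simp)
  then show "y \<in> standard_simplex W" using z s by (auto simp: standard_simplex_def)
qed (auto simp: standard_simplex_def)

definition quadratic_cost :: "real \<Rightarrow> nat \<Rightarrow> (nat \<Rightarrow> real) \<Rightarrow> (nat \<Rightarrow> real) \<Rightarrow> real" where
  "quadratic_cost b W V y = (\<Sum>w\<le>W. V w * y w + 1 / b * (y w)\<^sup>2)"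

definition quadratic_response :: "real \<Rightarrow> nat \<Rightarrow> (nat \<Rightarrow> real) \<Rightarrow> nat \<Rightarrow> real" where
  "quadratic_response b W V =
    (THE y. is_arg_min (quadratic_cost b W V) (\<lambda>y. y \<in> standard_simplex W) y)"

definition logit_response :: "real \<Rightarrow> nat \<Rightarrow> (nat \<Rightarrow> real) \<Rightarrow> nat \<Rightarrow> real" where
  "logit_response b W V w = exp (- b * V w) / (\<Sum>k\<le>W. exp (- b * V k))"

text \<open>The definite description in \<^const>\<open>quadratic_response\<close> is well defined.\<close>

lemma ex1_quadratic_minimizer:
  assumes "b > 0"
  shows "\<exists>!y. is_arg_min (quadratic_cost b W V) (\<lambda>y. y \<in> standard_simplex W) y"
proof -
  let ?S = "standard_simplex W" and ?f = "quadratic_cost b W V"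
  have comp: "compact ?S"
    using compactin_standard_simplex[of W]
    by (simp add: euclidean_product_topology flip: compactin_euclidean_iff)
  have cont: "continuous_on ?S ?f"
    unfolding quadratic_cost_def
    by (intro continuous_intros continuous_on_subset[OF continuous_on_product_coordinates] subset_UNIV)
  obtain x where x: "x \<in> ?S" "\<And>y. y \<in> ?S \<Longrightarrow> ?f x \<le> ?f y"
    using continuous_attains_inf[OF comp nonempty_standard_simplex cont] by auto
  show ?thesis
  proof (rule ex1I)
    show "is_arg_min ?f (\<lambda>y. y \<in> ?S) x"
      using x by (auto simp: is_arg_min_def not_less)
  next
    fix y assume "is_arg_min ?f (\<lambda>y. y \<in> ?S) y"
    then have y: "y \<in> ?S" "?f y \<le> ?f x"
      using x by (auto simp: is_arg_min_def not_less)
    define m where "m w = (x w + y w) / 2" for w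
    have "(\<Sum>w\<le>W. m w) = ((\<Sum>w\<le>W. x w) + (\<Sum>w\<le>W. y w)) / 2"
      unfolding m_def by (simp add: sum.distrib flip: sum_divide_distrib)
    then have m: "m \<in> ?S"
      using x(1) y(1) by (auto simp: standard_simplex_iff_nonneg_sum m_def)
    have "2 * ?f m + (\<Sum>w\<le>W. 1 / b * ((x w - y w)\<^sup>2 / 2)) = ?f x + ?f y"
      unfolding quadratic_cost_def sum_distrib_left sum.distrib[symmetric] m_def
      by (intro sum.cong refl) (use assms in \<open>simp add: field_simps power2_eq_square\<close>)
    then have "(\<Sum>w\<le>W. 1 / b * ((x w - y w)\<^sup>2 / 2)) \<le> 0"
      using x(2)[OF m] y(2) by linarith
    moreover have nn: "\<And>w. 0 \<le> 1 / b * ((x w - y w)\<^sup>2 / 2)"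
      using assms by simp
    ultimately have "(\<Sum>w\<le>W. 1 / b * ((x w - y w)\<^sup>2 / 2)) = 0"
      by (meson order_antisym sum_nonneg)
    then have "\<forall>w\<le>W. x w = y w"
      using nn assms by (simp add: sum_nonneg_eq_0_iff)
    moreover have "\<forall>w>W. x w = y w"
      using x(1) y(1) by (simp add: standard_simplex_def)
    ultimately show "y = x" by (metis ext not_le)
  qed
qed

end

theory Submission
  imports Defs
begin

text \<open>
  Moving mass between two coordinates shows that marginal costs at the quadratic minimizer are
  minimal on its support; hence coordinate \<open>w\<close> vanishes iff \<open>(\<Sum>k<w. V w - V k) \<ge> 2 / \<beta>'\<close>, which for
  \<open>\<beta>' = \<beta> e / 4\<close> reads \<open>(\<Sum>k<w. d k) \<ge> 8 / e\<close> with \<open>d k = \<beta> (V w - V k)\<close>. The logit response is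
  \<open>1 / (\<Sum>k\<le>W. exp (d k))\<close>. Convexity of \<open>exp\<close> bounds this sum below by \<open>1 + w exp (8 / (w e))\<close>
  when the condition holds; when it fails, every \<open>d k\<close> with \<open>k < w\<close> is less than \<open>8 / e\<close>, which
  bounds the sum above.
\<close>

lemma quadratic_response_is_arg_min:
  assumes "b > 0"
  shows "is_arg_min (quadratic_cost b W V) (\<lambda>y. y \<in> standard_simplex W) (quadratic_response b W V)"
  unfolding quadratic_response_def by (rule theI'[OF ex1_quadratic_minimizer[OF assms]])

lemma
  assumes "b > 0"
  shows quadratic_response_nonneg: "w \<le> W \<Longrightarrow> 0 \<le> quadratic_response b W V w"
    and quadratic_response_sum: "(\<Sum>w\<le>W. quadratic_response b W V w) = 1"
  using quadratic_response_is_arg_min[OF assms, of W V]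
  by (auto simp: is_arg_min_def standard_simplex_iff_nonneg_sum)

text \<open>Tracks a transfer of mass from \<open>i\<close> to \<open>j\<close>: it is applied with
  \<open>g\<close> returning its second argument, for the total mass, and with \<open>g\<close> the
  cost per coordinate, for the total cost.\<close>

lemma sum_fun_upd2:
  fixes g :: "'a \<Rightarrow> 'b \<Rightarrow> 'c::ab_group_add"
  assumes "finite A" "i \<in> A" "j \<in> A" "i \<noteq> j"
  shows "(\<Sum>x\<in>A. g x ((y(i := s, j := t)) x)) = (\<Sum>x\<in>A. g x (y x)) + (g i s - g i (y i)) + (g j t - g j (y j))"
proof -
  have "(\<Sum>x\<in>A. h x) = h i + h j + (\<Sum>x\<in>A - {i} - {j}. h x)" for h :: "'a \<Rightarrow> 'c"
    using assms by (simp add: sum.remove[of A i] sum.remove[of "A - {i}" j] add.assoc)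
  note split = this
  have rest: "(\<Sum>x\<in>A - {i} - {j}. g x ((y(i := s, j := t)) x)) = (\<Sum>x\<in>A - {i} - {j}. g x (y x))"
    by (intro sum.cong) auto
  show ?thesis
    unfolding split[of "\<lambda>x. g x ((y(i := s, j := t)) x)"] split[of "\<lambda>x. g x (y x)"] rest
    using assms(4) by simp
qed

text \<open>First-order optimality: since coordinate \<open>i\<close> carries mass, a little of it
  can be moved to \<open>j\<close>, and the cost must not drop.\<close>

lemma quadratic_response_marginal_cost_le:
  assumes b: "b > 0" and i: "i \<le> W" and j: "j \<le> W"
    and pos: "0 < quadratic_response b W V i"
  shows "V i + 2 / b * quadratic_response b W V i \<le> V j + 2 / b * quadratic_response b W V j"
proof (cases "i = j")
  case False
  define y where "y = quadratic_response b W V"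
  have simplex: "\<forall>w\<le>W. 0 \<le> y w" "\<forall>w>W. y w = 0" "(\<Sum>w\<le>W. y w) = 1"
    and min: "\<And>z. z \<in> standard_simplex W \<Longrightarrow> quadratic_cost b W V y \<le> quadratic_cost b W V z"
    using quadratic_response_is_arg_min[OF b, of W V]
    by (auto simp: is_arg_min_def standard_simplex_iff_nonneg_sum y_def not_less)
  \<comment> \<open>This is the cost change divided by \<epsilon>; the term
    \<open>2 / b * \<epsilon>\<close> collects the contribution \<epsilon>^2 / b of each of the two
    squares.\<close>
  have slope: "0 \<le> (V j + 2 / b * y j) - (V i + 2 / b * y i) + 2 / b * \<epsilon>"
    if \<epsilon>: "0 < \<epsilon>" "\<epsilon> \<le> y i" for \<epsilon>
  proof -
    define z where "z = y(i := y i - \<epsilon>, j := y j + \<epsilon>)"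
    have "(\<Sum>w\<le>W. z w) = 1"
      using sum_fun_upd2[of "{..W}" i j "\<lambda>_ t. t" y "y i - \<epsilon>" "y j + \<epsilon>"] i j False simplex(3)
      by (simp add: z_def)
    then have "z \<in> standard_simplex W"
      using simplex i j \<epsilon> by (auto simp: standard_simplex_iff_nonneg_sum z_def)
    then have "quadratic_cost b W V y \<le> quadratic_cost b W V z"
      by (rule min)
    also have "\<dots> = quadratic_cost b W V y + \<epsilon> * ((V j + 2 / b * y j) - (V i + 2 / b * y i) + 2 / b * \<epsilon>)"
      unfolding quadratic_cost_def z_def
      using sum_fun_upd2[of "{..W}" i j "\<lambda>w t. V w * t + 1 / b * t\<^sup>2" y "y i - \<epsilon>" "y j + \<epsilon>"] i j False
      by (simp add: algebra_simps power2_eq_square)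
    finally show ?thesis
      using \<epsilon> by (simp add: zero_le_mult_iff)
  qed
  have "V i + 2 / b * y i \<le> V j + 2 / b * y j + \<delta>" if "0 < \<delta>" for \<delta>
  proof -
    \<comment> \<open>As shift size, this minimum keeps coordinate \<open>i\<close> nonnegative and
      the second-order term at most \<delta>.\<close>
    have "0 < min (y i) (b / 2 * \<delta>)"
      using pos b that by (simp add: y_def)
    from slope[OF this] have "V i + 2 / b * y i \<le> V j + 2 / b * y j + 2 / b * min (y i) (b / 2 * \<delta>)"
      by simp
    also have "2 / b * min (y i) (b / 2 * \<delta>) \<le> 2 / b * (b / 2 * \<delta>)"
      using b by (intro mult_left_mono) auto
    finally show ?thesis
      using b by simp
  qed
  then show ?thesis
    unfolding y_def by (rule field_le_epsilon)
qed simp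

text \<open>Comparing the marginal cost at \<open>w\<close> with those at all \<open>k < w\<close>
  and summing relates the gaps \<open>V w - V k\<close> to \<open>2 / b\<close> times the mass below
  \<open>w\<close>. That mass is 1 if \<open>y w = 0\<close> and less than 1 otherwise.\<close>

lemma quadratic_response_eq_0_iff:
  assumes b: "b > 0" and mono: "mono_on {0..W} V" and w: "w \<le> W"
  shows "quadratic_response b W V w = 0 \<longleftrightarrow> 2 / b \<le> (\<Sum>k<w. V w - V k)"
proof -
  define y where "y = quadratic_response b W V"
  have nn: "k \<le> W \<Longrightarrow> 0 \<le> y k" for k
    using quadratic_response_nonneg[OF b] by (simp add: y_def)
  have sum1: "(\<Sum>k\<le>W. y k) = 1"
    using quadratic_response_sum[OF b] by (simp add: y_def)
  have marginal: "V i + 2 / b * y i \<le> V j + 2 / b * y j" if "i \<le> W" "j \<le> W" "0 < y i" for i j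
    using quadratic_response_marginal_cost_le[OF b] that by (simp add: y_def)
  have V: "V i \<le> V j" if "i \<le> j" "j \<le> W" for i j
    using mono_onD[OF mono] that by simp
  have "2 / b \<le> (\<Sum>k<w. V w - V k)" if zero: "y w = 0"
  proof -
    \<comment> \<open>Mass at some \<open>k\<close> from \<open>w\<close> on would have marginal
      cost strictly above \<open>V w\<close>, the marginal cost at the empty coordinate
      \<open>w\<close>.\<close>
    have "y k = 0" if "k \<in> {..W} - {..<w}" for k
    proof (rule ccontr)
      assume "y k \<noteq> 0"
      then have "0 < y k" using nn[of k] that by auto
      then have "0 < 2 / b * y k" using b by simp
      then show False
        using marginal[of k w] V[of w k] \<open>0 < y k\<close> that w zero by auto
    qed
    then have "(\<Sum>k<w. y k) = (\<Sum>k\<le>W. y k)"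
      using w by (intro sum.mono_neutral_left) auto
    then have "2 / b = (\<Sum>k<w. 2 / b * y k)"
      by (simp add: sum1 sum_distrib_left[symmetric] del: times_divide_eq_left)
    also have "\<dots> \<le> (\<Sum>k<w. V w - V k)"
    proof (rule sum_mono)
      fix k assume "k \<in> {..<w}"
      \<comment> \<open>Off the support this is just monotonicity of \<open>V\<close>.\<close>
      then show "2 / b * y k \<le> V w - V k"
        using marginal[of k w] V[of k w] nn[of k] w zero by (cases "y k = 0") auto
    qed
    finally show ?thesis .
  qed
  moreover have "(\<Sum>k<w. V w - V k) < 2 / b" if "y w \<noteq> 0"
  proof -
    have pos: "0 < y w" using that nn[OF w] by simp
    have "(\<Sum>k<w. V w - V k) \<le> (\<Sum>k<w. 2 / b * y k)"
    proof (rule sum_mono)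
      fix k assume "k \<in> {..<w}"
      moreover have "0 < 2 / b * y w" using pos b by simp
      ultimately show "V w - V k \<le> 2 / b * y k"
        using marginal[of w k] pos w by auto
    qed
    also have "\<dots> = 2 / b * (\<Sum>k<w. y k)"
      by (rule sum_distrib_left[symmetric])
    \<comment> \<open>Strict because the added term \<open>y w\<close> is positive.\<close>
    also have "\<dots> < 2 / b * (\<Sum>k<Suc w. y k)"
      using b pos by (intro mult_strict_left_mono) auto
    also have "\<dots> \<le> 2 / b * (\<Sum>k\<le>W. y k)"
      using b w nn by (intro mult_left_mono sum_mono2) auto
    finally show ?thesis by (simp add: sum1)
  qed
  ultimately show ?thesis
    unfolding y_def by fastforce
qed

text \<open>Dividing through by the numerator expresses the response in the same gaps
  \<open>V w - V k\<close> as the quadratic criterion.\<close>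

lemma logit_response_eq_inverse_sum:
  "logit_response b W V w = 1 / (\<Sum>k\<le>W. exp (b * (V w - V k)))"
proof -
  have "(\<Sum>k\<le>W. exp (- b * V k)) = exp (- b * V w) * (\<Sum>k\<le>W. exp (b * (V w - V k)))"
    by (simp add: sum_distrib_left algebra_simps flip: exp_add)
  then show ?thesis
    by (simp add: logit_response_def)
qed

text \<open>The graph of \<open>exp\<close> lies above its tangent at \<open>m\<close>; summed over
  \<open>A\<close>, the linear terms of the tangent are nonnegative by assumption.\<close>

lemma sum_exp_ge_card_exp:
  fixes d :: "'a \<Rightarrow> real"
  assumes "finite A" "real (card A) * m \<le> (\<Sum>x\<in>A. d x)"
  shows "real (card A) * exp m \<le> (\<Sum>x\<in>A. exp (d x))"
proof -
  have "0 \<le> exp m * (\<Sum>x\<in>A. d x - m)"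
    using assms by (simp add: sum_subtractf)
  then have "real (card A) * exp m \<le> (\<Sum>x\<in>A. exp m * (1 + (d x - m)))"
    by (simp add: sum.distrib distrib_left flip: sum_distrib_left)
  also have "\<dots> \<le> (\<Sum>x\<in>A. exp (d x))"
  proof (rule sum_mono)
    fix x
    have "exp m * (1 + (d x - m)) \<le> exp m * exp (d x - m)"
      by (intro mult_left_mono exp_ge_add_one_self) simp
    then show "exp m * (1 + (d x - m)) \<le> exp (d x)"
      by (simp flip: exp_add)
  qed
  finally show ?thesis .
qed

text \<open>The right-hand side dominates the tangent of \<open>exp\<close> at 1, which passes
  through the origin.\<close>

lemma exp_ge_exp_1_mult: "exp 1 * x \<le> exp (x::real)"
proof -
  have "exp 1 * x \<le> exp 1 * exp (x - 1)"
    using exp_ge_add_one_self[of "x - 1"] by (intro mult_left_mono) auto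
  then show ?thesis by (simp flip: exp_add)
qed

theorem propositionC1:
  fixes W :: nat and \<beta> :: real and V :: "nat \<Rightarrow> real"
  assumes "W \<ge> 1" and "\<beta> > 0" and "mono_on {0..W} V"
  shows "\<forall>w\<in>{1..W}.
    (quadratic_response (\<beta> * exp 1 / 4) W V w = 0 \<longrightarrow>
       logit_response \<beta> W V w \<le> 1 / (1 + real w * exp (8 / (real w * exp 1)))) \<and>
    1 / (1 + real w * exp (8 / (real w * exp 1))) \<le> 1 / 9 \<and>
    (logit_response \<beta> W V w \<le> 1 / (real W + 1 + real w * (exp (8 / exp 1) - 1)) \<longrightarrow>
       quadratic_response (\<beta> * exp 1 / 4) W V w = 0)"
proof (intro ballI conjI impI)
  fix w assume "w \<in> {1..W}"
  then have w: "1 \<le> w" "w \<le> W" by auto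
  define d where "d k = \<beta> * (V w - V k)" for k
  have logit: "logit_response \<beta> W V w = 1 / (\<Sum>k\<le>W. exp (d k))"
    by (simp add: logit_response_eq_inverse_sum d_def)
  have "(\<Sum>k<w. d k) = \<beta> * (\<Sum>k<w. V w - V k)"
    by (simp add: d_def sum_distrib_left)
  then have quad: "quadratic_response (\<beta> * exp 1 / 4) W V w = 0 \<longleftrightarrow> 8 / exp 1 \<le> (\<Sum>k<w. d k)"
    using quadratic_response_eq_0_iff[of "\<beta> * exp 1 / 4" W V w] assms w
    by (simp add: field_simps)
  have V: "V i \<le> V j" if "i \<le> j" "j \<le> W" for i j
    using mono_onD[OF assms(3)] that by simp
  have d_nonneg: "0 \<le> d k" if "k < w" for k
    using V[of k w] that w assms(2) by (simp add: d_def)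
  have d_nonpos: "d k \<le> 0" if "w \<le> k" "k \<le> W" for k
    using V[of w k] that assms(2) by (simp add: d_def mult_nonneg_nonpos)
  have split: "(\<Sum>k\<le>W. exp (d k)) = (\<Sum>k<w. exp (d k)) + (\<Sum>k=w..W. exp (d k))"
    using w by (subst sum.union_disjoint[symmetric]) (auto intro: sum.cong)

  show "logit_response \<beta> W V w \<le> 1 / (1 + real w * exp (8 / (real w * exp 1)))"
    if "quadratic_response (\<beta> * exp 1 / 4) W V w = 0"
  proof -
    have "real w * exp (8 / (real w * exp 1)) \<le> (\<Sum>k<w. exp (d k))"
      using sum_exp_ge_card_exp[of "{..<w}" "8 / (real w * exp 1)" d] that w quad by simp
    \<comment> \<open>Of the terms from \<open>w\<close> on, only \<open>k = w\<close> is kept; as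
      \<open>d w = 0\<close>, it supplies the summand 1.\<close>
    moreover have "exp (d w) \<le> (\<Sum>k=w..W. exp (d k))"
      using w by (intro member_le_sum) auto
    ultimately have "1 + real w * exp (8 / (real w * exp 1)) \<le> (\<Sum>k\<le>W. exp (d k))"
      unfolding split by (simp add: d_def)
    then show ?thesis
      unfolding logit by (intro divide_left_mono) (auto intro!: mult_pos_pos add_pos_nonneg sum_pos)
  qed

  have "8 \<le> real w * exp (8 / (real w * exp 1))"
    using mult_left_mono[OF exp_ge_exp_1_mult[of "8 / (real w * exp 1)"], of "real w"] w by simp
  then show "1 / (1 + real w * exp (8 / (real w * exp 1))) \<le> 1 / 9"
    by (intro divide_left_mono) auto

  show "quadratic_response (\<beta> * exp 1 / 4) W V w = 0"
    if le: "logit_response \<beta> W V w \<le> 1 / (real W + 1 + real w * (exp (8 / exp 1) - 1))"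
  proof (rule ccontr)
    assume "quadratic_response (\<beta> * exp 1 / 4) W V w \<noteq> 0"
    then have less: "(\<Sum>k<w. d k) < 8 / exp 1" using quad by simp
    \<comment> \<open>Strictness is what contradicts the non-strict bound \<open>le\<close>; it
      relies on \<open>w\<close> being at least 1, so that the sum is nonempty.\<close>
    have "(\<Sum>k<w. exp (d k)) < (\<Sum>k<w. exp (8 / exp 1))"
    proof (rule sum_strict_mono)
      fix k assume k: "k \<in> {..<w}"
      then have "d k \<le> (\<Sum>k<w. d k)"
        using d_nonneg by (intro member_le_sum) auto
      then show "exp (d k) < exp (8 / exp 1)" using less by simp
    qed (use w in \<open>auto simp: lessThan_empty_iff\<close>)
    \<comment> \<open>These \<open>W + 1 - w\<close> terms, together with \<open>w\<close> terms
      below \<open>exp (8 / exp 1)\<close>, give exactly the denominator in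
      \<open>le\<close>.\<close>
    moreover have "(\<Sum>k=w..W. exp (d k)) \<le> (\<Sum>k=w..W. 1)"
      using d_nonpos by (intro sum_mono) auto
    ultimately have "(\<Sum>k\<le>W. exp (d k)) < real W + 1 + real w * (exp (8 / exp 1) - 1)"
      unfolding split using w by (simp add: algebra_simps of_nat_diff)
    moreover have "0 < (\<Sum>k\<le>W. exp (d k))"
      by (intro sum_pos) auto
    ultimately show False
      using le unfolding logit by (simp add: divide_simps split: if_splits)
  qed
qed

end
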